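(* Let $f:\mathbb{R}^n\to \mathbb{R}^n$ be an $L$-bilipschitz mapping, that is, $|x-y|/L\le |f(x)-f(y)|\le L|x-y|$ for all $x,y\in \mathbb{R}^n$. If $G\subsetneq \mathbb{R}^n$ is $\varphi$-uniform, then $f(G)$ is $\varphi_1$-uniform with $\varphi_1(t)=L^2\varphi(L^2t)$.
   Context: Throughout $n\ge 2$; a domain is an open connected non-empty subset of $\mathbb{R}^n$. For a domain $G\subsetneq\mathbb{R}^n$ and $x\in G$, $\delta_G(x)$ is the Euclidean distance from $x$ to $\partial G$. The quasihyperbolic metric of $G$ is $k_G(x,y)=\inf_{\gamma}\int_\gamma \frac{|dz|}{\delta_G(z)}$, the infimum being over all rectifiable paths $\gamma\subset G$ joining $x$ and $y$. For a homeomorphism $\varphi:[0,\infty)\to[0,\infty)$, a domain $G\subsetneq\mathbb{R}^n$ is called $\varphi$-uniform if $k_G(x,y)\le \varphi\big(|x-y|/\min\{\delta_G(x),\delta_G(y)\}\big)$ for all $x,y\in G$. *)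

theory Defs
  imports "HOL-Analysis.Analysis"
begin

definition euclidean_domain :: "'a::euclidean_space set \<Rightarrow> bool" where
  "euclidean_domain G \<longleftrightarrow> open G \<and> connected G \<and> G \<noteq> {}"

definition boundary_dist :: "'a::euclidean_space set \<Rightarrow> 'a \<Rightarrow> real" where
  "boundary_dist G x = infdist x (frontier G)"

definition chord_sums :: "(real \<Rightarrow> 'a::metric_space) \<Rightarrow> real \<Rightarrow> real \<Rightarrow> real set" where
  "chord_sums \<gamma> a b =
     {(\<Sum>i<m. dist (\<gamma> (t i)) (\<gamma> (t (Suc i)))) | (m::nat) (t::nat \<Rightarrow> real).
        t 0 = a \<and> t m = b \<and> (\<forall>i<m. t i \<le> t (Suc i))}"

definition rectifiable_path :: "(real \<Rightarrow> 'a::metric_space) \<Rightarrow> bool" where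
  "rectifiable_path \<gamma> \<longleftrightarrow> path \<gamma> \<and> bdd_above (chord_sums \<gamma> 0 1)"

definition curve_length :: "(real \<Rightarrow> 'a::metric_space) \<Rightarrow> real \<Rightarrow> real \<Rightarrow> real" where
  "curve_length \<gamma> a b = Sup (chord_sums \<gamma> a b)"

text \<open>The arc length parametrization is the map \<open>\<gamma>\<^sub>0\<close> on \<open>[0, \<ell>(\<gamma>)]\<close> determined by
  \<open>\<gamma> = \<gamma>\<^sub>0 \<circ> s\<close>, where \<open>s t\<close> is the length of \<open>\<gamma>\<close> restricted to \<open>[0, t]\<close>. The choice of the
  parameter is immaterial: if \<open>s t = s t'\<close> then \<open>\<gamma>\<close> is constant between \<open>t\<close> and \<open>t'\<close>.\<close>

definition arclength_param :: "(real \<Rightarrow> 'a::metric_space) \<Rightarrow> real \<Rightarrow> 'a" where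
  "arclength_param \<gamma> s = \<gamma> (SOME t. t \<in> {0..1} \<and> curve_length \<gamma> 0 t = s)"

definition arclength_integral :: "(real \<Rightarrow> 'a::metric_space) \<Rightarrow> ('a \<Rightarrow> real) \<Rightarrow> real" where
  "arclength_integral \<gamma> \<rho> =
     integral {0..curve_length \<gamma> 0 1} (\<lambda>s. \<rho> (arclength_param \<gamma> s))"

definition quasihyperbolic_dist :: "'a::euclidean_space set \<Rightarrow> 'a \<Rightarrow> 'a \<Rightarrow> real" where
  "quasihyperbolic_dist G x y =
     (INF \<gamma> \<in> {\<gamma>. rectifiable_path \<gamma> \<and> path_image \<gamma> \<subseteq> G \<and> pathstart \<gamma> = x \<and> pathfinish \<gamma> = y}.
        arclength_integral \<gamma> (\<lambda>z. 1 / boundary_dist G z))"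

definition phi_uniform :: "(real \<Rightarrow> real) \<Rightarrow> 'a::euclidean_space set \<Rightarrow> bool" where
  "phi_uniform \<phi> G \<longleftrightarrow>
     (\<exists>\<psi>. homeomorphism {0..} {0..} \<phi> \<psi>) \<and>
     euclidean_domain G \<and> G \<noteq> UNIV \<and>
     (\<forall>x\<in>G. \<forall>y\<in>G. quasihyperbolic_dist G x y
        \<le> \<phi> (norm (x - y) / min (boundary_dist G x) (boundary_dist G y)))"

end

theory Submission
  imports Defs
begin

text \<open>By invariance of domain, \<open>f\<close> is a homeomorphism of the whole space, so it maps the boundary of
  \<open>G\<close> onto that of \<open>f(G)\<close> and distorts distances to the boundary by at most the factor \<open>L\<close>. It also
  stretches the length of every subpath by at most \<open>L\<close>; hence the arc length of \<open>f \<circ> \<gamma>\<close> is an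
  \<open>L\<close>-Lipschitz monotone function \<open>u\<close> of the arc length of \<open>\<gamma>\<close>, and substituting \<open>u\<close> in the arc length
  integral costs another factor \<open>L\<close>. Thus quasihyperbolic distances grow by at most \<open>L\<^sup>2\<close>, while
  \<open>|x - y| / min \<delta>\<close> changes by at most \<open>L\<^sup>2\<close> and \<open>\<phi>\<close> is increasing.

  Since \<open>u\<close> need not be differentiable, the substitution inequality is proved by comparing increments
  over small intervals. Arc length parametrizations are defined everywhere because the length of an
  initial piece of a rectifiable path depends continuously on its endpoint.\<close>

section \<open>Length of rectifiable paths\<close>

lemma chord_sums_start: "0 \<in> chord_sums \<gamma> a a"
  unfolding chord_sums_def by (auto intro!: exI[of _ "0::nat"] exI[of _ "\<lambda>_. a"])

lemma chord_sums_step: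
  assumes "S \<in> chord_sums \<gamma> a b" "b \<le> c"
  shows "S + dist (\<gamma> b) (\<gamma> c) \<in> chord_sums \<gamma> a c"
proof -
  obtain m and t :: "nat \<Rightarrow> real" where *: "S = (\<Sum>i<m. dist (\<gamma> (t i)) (\<gamma> (t (Suc i))))"
    "t 0 = a" "t m = b" "\<forall>i<m. t i \<le> t (Suc i)"
    using assms(1) unfolding chord_sums_def by auto
  define t' where "t' = t(Suc m := c)"
  have "S + dist (\<gamma> b) (\<gamma> c) = (\<Sum>i<Suc m. dist (\<gamma> (t' i)) (\<gamma> (t' (Suc i))))"
    using * by (simp add: t'_def)
  moreover have "t' 0 = a" "t' (Suc m) = c" "\<forall>i<Suc m. t' i \<le> t' (Suc i)"
    using * assms(2) by (auto simp: t'_def less_Suc_eq)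
  ultimately show ?thesis unfolding chord_sums_def by blast
qed

text \<open>Cutting a partition off at its \<open>k\<close>-th point leaves a partition ending at
  \<open>t k\<close>, so induction on \<open>k\<close> works with a moving right endpoint. From here
  on chord sums are treated as an inductively generated family, and partitions need not be handled
  explicitly.\<close>

lemma chord_sums_induct [consumes 1, case_names start step]:
  assumes "S \<in> chord_sums \<gamma> a b"
    and start: "P 0 a"
    and step: "\<And>S b c. \<lbrakk>S \<in> chord_sums \<gamma> a b; a \<le> b; b \<le> c; P S b\<rbrakk> \<Longrightarrow> P (S + dist (\<gamma> b) (\<gamma> c)) c"
  shows "P S b"
proof -
  obtain m and t :: "nat \<Rightarrow> real" where *: "S = (\<Sum>i<m. dist (\<gamma> (t i)) (\<gamma> (t (Suc i))))"
    "t 0 = a" "t m = b" "\<forall>i<m. t i \<le> t (Suc i)"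
    using assms(1) unfolding chord_sums_def by auto
  let ?S = "\<lambda>k. \<Sum>i<k. dist (\<gamma> (t i)) (\<gamma> (t (Suc i)))"
  have "k \<le> m \<Longrightarrow> ?S k \<in> chord_sums \<gamma> a (t k) \<and> a \<le> t k \<and> P (?S k) (t k)" for k
  proof (induction k)
    case 0
    then show ?case using start *(2) by (simp add: chord_sums_start)
  next
    case (Suc k)
    then have "t k \<le> t (Suc k)" using *(4) by auto
    with Suc show ?case
      using chord_sums_step[of "?S k" \<gamma> a "t k" "t (Suc k)"] step[of "?S k" "t k" "t (Suc k)"] by auto
  qed
  from this[of m] show ?thesis using * by auto
qed

lemma chord_sums_single: "a \<le> b \<Longrightarrow> dist (\<gamma> a) (\<gamma> b) \<in> chord_sums \<gamma> a b"
  using chord_sums_step[OF chord_sums_start] by fastforce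

lemma chord_sums_concat:
  assumes "T \<in> chord_sums \<gamma> b c" "S \<in> chord_sums \<gamma> a b"
  shows "S + T \<in> chord_sums \<gamma> a c"
  using assms(1)
proof (induction rule: chord_sums_induct)
  case start
  then show ?case using assms(2) by simp
next
  case (step T b c)
  then show ?case using chord_sums_step[of "S + T" \<gamma> a b c] by (simp add: add.assoc)
qed

text \<open>Reading a partition backwards reflects it. This symmetry later carries estimates at the
  right end of an interval over to the left end.\<close>

lemma chord_sums_uminus:
  "S \<in> chord_sums \<gamma> a b \<Longrightarrow> S \<in> chord_sums (\<lambda>t. \<gamma> (- t)) (- b) (- a)"
proof (induction rule: chord_sums_induct)
  case start
  then show ?case by (rule chord_sums_start)
next
  case (step S b c)
  have "dist (\<gamma> b) (\<gamma> c) \<in> chord_sums (\<lambda>t. \<gamma> (- t)) (- c) (- b)"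
    using chord_sums_single[of "-c" "-b" "\<lambda>t. \<gamma> (- t)"] step by (simp add: dist_commute)
  from chord_sums_concat[OF step(4) this] show ?case by (simp add: add.commute)
qed

lemma chord_sums_uminus_eq: "chord_sums (\<lambda>t. \<gamma> (- t)) (- b) (- a) = chord_sums \<gamma> a b"
  using chord_sums_uminus[of _ "\<lambda>t. \<gamma> (- t)" "-b" "-a"] chord_sums_uminus[of _ \<gamma> a b] by auto

lemma curve_length_uminus: "curve_length (\<lambda>t. \<gamma> (- t)) (- b) (- a) = curve_length \<gamma> a b"
  by (simp add: curve_length_def chord_sums_uminus_eq)

text \<open>Adding the chords from \<open>A\<close> to \<open>a\<close> and from \<open>b\<close> to
  \<open>B\<close> turns a chord sum of the small interval into one of the large interval that is at
  least as big.\<close>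

lemma bdd_above_chord_sums_subinterval:
  assumes "bdd_above (chord_sums \<gamma> A B)" "A \<le> a" "b \<le> B"
  shows "bdd_above (chord_sums \<gamma> a b)"
proof -
  obtain M where M: "\<And>S. S \<in> chord_sums \<gamma> A B \<Longrightarrow> S \<le> M"
    using assms(1) by (auto simp: bdd_above_def)
  have "S \<le> M" if "S \<in> chord_sums \<gamma> a b" for S
  proof -
    have "dist (\<gamma> A) (\<gamma> a) + S + dist (\<gamma> b) (\<gamma> B) \<in> chord_sums \<gamma> A B"
      using that assms by (intro chord_sums_step chord_sums_concat[OF that] chord_sums_single)
    from M[OF this] show ?thesis by (smt (verit) zero_le_dist)
  qed
  then show ?thesis by (auto simp: bdd_above_def)
qed

section \<open>Length as a supremum: additivity and continuity\<close>

lemma curve_length_ge: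
  "\<lbrakk>bdd_above (chord_sums \<gamma> a b); S \<in> chord_sums \<gamma> a b\<rbrakk> \<Longrightarrow> S \<le> curve_length \<gamma> a b"
  unfolding curve_length_def by (rule cSup_upper)

lemma curve_length_le:
  assumes "a \<le> b" "\<And>S. S \<in> chord_sums \<gamma> a b \<Longrightarrow> S \<le> M"
  shows "curve_length \<gamma> a b \<le> M"
  unfolding curve_length_def using assms chord_sums_single[OF assms(1)] by (intro cSup_least) auto

lemma curve_length_refl [simp]: "curve_length \<gamma> a a = 0"
proof -
  have "S = 0" if "S \<in> chord_sums \<gamma> a b" "b = a" for S b
    using that by (induction rule: chord_sums_induct) auto
  then have "chord_sums \<gamma> a a = {0}" using chord_sums_start by auto
  then show ?thesis by (simp add: curve_length_def)
qed

text \<open>One direction cuts the chord that passes over \<open>b\<close> with the triangle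
  inequality; the other concatenates partitions and takes the two suprema one after the
  other.\<close>

lemma curve_length_add:
  assumes bdd: "bdd_above (chord_sums \<gamma> a c)" and "a \<le> b" "b \<le> c"
  shows "curve_length \<gamma> a c = curve_length \<gamma> a b + curve_length \<gamma> b c"
proof (rule antisym)
  note bdd' = bdd_above_chord_sums_subinterval[OF bdd]
  \<comment> \<open>The right endpoint \<open>x\<close> has to vary over \<open>[b, c]\<close> for
    the induction to go through.\<close>
  have "b \<le> x \<Longrightarrow> x \<le> c \<Longrightarrow> S \<le> curve_length \<gamma> a b + curve_length \<gamma> b x"
    if "S \<in> chord_sums \<gamma> a x" for S x
    using that
  proof (induction rule: chord_sums_induct)
    case start
    then show ?case using assms by simp
  next
    case (step S y z)
    show ?case
    proof (cases "b \<le> y")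
      case True
      have "T + dist (\<gamma> y) (\<gamma> z) \<le> curve_length \<gamma> b z" if "T \<in> chord_sums \<gamma> b y" for T
        using that step assms by (intro curve_length_ge bdd' chord_sums_step) auto
      then have "curve_length \<gamma> b y \<le> curve_length \<gamma> b z - dist (\<gamma> y) (\<gamma> z)"
        using True by (intro curve_length_le) (auto simp: algebra_simps)
      then show ?thesis using step True by auto
    next
      case False
      then have "S + dist (\<gamma> y) (\<gamma> b) \<le> curve_length \<gamma> a b"
        using step assms by (intro curve_length_ge bdd' chord_sums_step) auto
      moreover have "dist (\<gamma> b) (\<gamma> z) \<le> curve_length \<gamma> b z"
        using step assms by (intro curve_length_ge bdd' chord_sums_single) auto
      ultimately show ?thesis using dist_triangle[of "\<gamma> y" "\<gamma> z" "\<gamma> b"] by linarith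
    qed
  qed
  then show "curve_length \<gamma> a c \<le> curve_length \<gamma> a b + curve_length \<gamma> b c"
    using assms by (intro curve_length_le) auto
  have "curve_length \<gamma> a b \<le> curve_length \<gamma> a c - T" if T: "T \<in> chord_sums \<gamma> b c" for T
  proof (rule curve_length_le)
    fix S assume "S \<in> chord_sums \<gamma> a b"
    then show "S \<le> curve_length \<gamma> a c - T"
      using curve_length_ge[OF bdd chord_sums_concat[OF T]] by (simp add: algebra_simps)
  qed (use assms in auto)
  then have "curve_length \<gamma> b c \<le> curve_length \<gamma> a c - curve_length \<gamma> a b"
    using assms by (intro curve_length_le) (auto simp: algebra_simps)
  then show "curve_length \<gamma> a b + curve_length \<gamma> b c \<le> curve_length \<gamma> a c" by simp
qed

lemma dist_le_curve_length:
  "\<lbrakk>bdd_above (chord_sums \<gamma> a b); a \<le> b\<rbrakk> \<Longrightarrow> dist (\<gamma> a) (\<gamma> b) \<le> curve_length \<gamma> a b"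
  by (intro curve_length_ge chord_sums_single)

text \<open>The length of a short final piece exceeds its chord by at most \<open>\<epsilon>\<close>: refining a partition
  whose chord sum is within \<open>\<epsilon>\<close> of the total length cannot lose anything.\<close>

lemma curve_length_final_piece:
  assumes bdd: "bdd_above (chord_sums \<gamma> a b)" and "a < b" "\<epsilon> > 0"
  obtains c where "a \<le> c" "c < b" "\<And>s. c \<le> s \<Longrightarrow> s \<le> b \<Longrightarrow> curve_length \<gamma> s b \<le> dist (\<gamma> s) (\<gamma> b) + \<epsilon>"
proof -
  note bdd' = bdd_above_chord_sums_subinterval[OF bdd]
  \<comment> \<open>The witness \<open>c\<close> is the last partition point strictly before
    \<open>x\<close>; a degenerate step \<open>y = z\<close> adds nothing and keeps the earlier
    witness.\<close>
  have *: "a < x \<Longrightarrow> x \<le> b \<Longrightarrow> \<exists>c. a \<le> c \<and> c < x \<and> (\<forall>s. c \<le> s \<and> s \<le> x \<longrightarrow> S \<le> curve_length \<gamma> a s + dist (\<gamma> s) (\<gamma> x))"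
    if "S \<in> chord_sums \<gamma> a x" for S x
    using that
  proof (induction rule: chord_sums_induct)
    case start
    then show ?case by simp
  next
    case (step S y z)
    show ?case
    proof (cases "y = z")
      case True
      then show ?thesis using step by auto
    next
      case False
      have "S + dist (\<gamma> y) (\<gamma> z) \<le> curve_length \<gamma> a s + dist (\<gamma> s) (\<gamma> z)" if "y \<le> s" "s \<le> z" for s
      proof -
        have "S + dist (\<gamma> y) (\<gamma> s) \<le> curve_length \<gamma> a s"
          using step that by (intro curve_length_ge bdd' chord_sums_step) auto
        then show ?thesis using dist_triangle[of "\<gamma> y" "\<gamma> z" "\<gamma> s"] by linarith
      qed
      then show ?thesis using step False by (intro exI[of _ y]) auto
    qed
  qed
  have ne: "chord_sums \<gamma> a b \<noteq> {}" using chord_sums_single[of a b] assms by force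
  obtain S where S: "S \<in> chord_sums \<gamma> a b" "curve_length \<gamma> a b - \<epsilon> < S"
    using less_cSup_iff[OF ne bdd, of "curve_length \<gamma> a b - \<epsilon>"] \<open>\<epsilon> > 0\<close>
    unfolding curve_length_def by auto
  obtain c where c: "a \<le> c" "c < b" "\<And>s. c \<le> s \<Longrightarrow> s \<le> b \<Longrightarrow> S \<le> curve_length \<gamma> a s + dist (\<gamma> s) (\<gamma> b)"
    using *[OF S(1)] assms by auto
  show ?thesis
  proof (rule that[OF c(1,2)])
    fix s assume "c \<le> s" "s \<le> b"
    then show "curve_length \<gamma> s b \<le> dist (\<gamma> s) (\<gamma> b) + \<epsilon>"
      using c(3)[of s] S(2) curve_length_add[OF bdd, of s] c(1) by auto
  qed
qed

text \<open>This is the estimate for final pieces applied to the reflected path on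
  \<open>[-b, -a]\<close>.\<close>

lemma curve_length_initial_piece:
  assumes bdd: "bdd_above (chord_sums \<gamma> a b)" and "a < b" "\<epsilon> > 0"
  obtains c where "a < c" "c \<le> b" "\<And>s. a \<le> s \<Longrightarrow> s \<le> c \<Longrightarrow> curve_length \<gamma> a s \<le> dist (\<gamma> a) (\<gamma> s) + \<epsilon>"
proof -
  obtain c where c: "- b \<le> c" "c < - a"
    "\<And>s. c \<le> s \<Longrightarrow> s \<le> - a \<Longrightarrow> curve_length (\<lambda>t. \<gamma> (- t)) s (- a) \<le> dist (\<gamma> (- s)) (\<gamma> (- (- a))) + \<epsilon>"
    using curve_length_final_piece[of "\<lambda>t. \<gamma> (- t)" "-b" "-a" \<epsilon>] assms
    by (auto simp: chord_sums_uminus_eq)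
  show ?thesis
  proof (rule that[of "- c"])
    fix s assume "a \<le> s" "s \<le> - c"
    then show "curve_length \<gamma> a s \<le> dist (\<gamma> a) (\<gamma> s) + \<epsilon>"
      using c(3)[of "- s"] by (simp add: curve_length_uminus dist_commute)
  qed (use c in auto)
qed

text \<open>Near \<open>x\<close> the length between \<open>s\<close> and \<open>x\<close> exceeds
  the chord by at most \<open>e/2\<close>, and continuity of \<open>\<gamma>\<close> makes the chord
  smaller than \<open>e/2\<close>. The two sides of \<open>x\<close> are handled separately.\<close>

lemma continuous_on_curve_length:
  assumes bdd: "bdd_above (chord_sums \<gamma> a b)" and cont: "continuous_on {a..b} \<gamma>"
  shows "continuous_on {a..b} (curve_length \<gamma> a)"
  unfolding continuous_on_iff
proof (intro ballI allI impI)
  fix x and e :: real assume x: "x \<in> {a..b}" and e: "e > 0"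
  note bdd' = bdd_above_chord_sums_subinterval[OF bdd]
  have add: "curve_length \<gamma> a t = curve_length \<gamma> a s + curve_length \<gamma> s t" if "a \<le> s" "s \<le> t" "t \<le> b" for s t
    using that by (intro curve_length_add bdd') auto
  have nn: "curve_length \<gamma> s t \<ge> 0" if "a \<le> s" "s \<le> t" "t \<le> b" for s t
    using dist_le_curve_length[OF bdd', of s t] that by (smt (verit) zero_le_dist)
  obtain d where d: "d > 0" "\<And>s. s \<in> {a..b} \<Longrightarrow> dist s x < d \<Longrightarrow> dist (\<gamma> s) (\<gamma> x) < e/2"
    using cont x e unfolding continuous_on_iff by (metis half_gt_zero)
  have left: "\<exists>l>0. \<forall>s. a \<le> s \<and> s \<le> x \<and> x - s < l \<longrightarrow> curve_length \<gamma> s x \<le> dist (\<gamma> s) (\<gamma> x) + e/2"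
  proof (cases "a < x")
    case True
    from curve_length_final_piece[OF bdd' True, of "e/2"] x e
    obtain c where c: "a \<le> c" "c < x" "\<And>s. c \<le> s \<Longrightarrow> s \<le> x \<Longrightarrow> curve_length \<gamma> s x \<le> dist (\<gamma> s) (\<gamma> x) + e/2"
      by auto
    then show ?thesis by (intro exI[of _ "x - c"]) auto
  next
    case False
    \<comment> \<open>At the left endpoint only \<open>s = x\<close> remains, so the radius 1 is an
      arbitrary choice; the right endpoint is treated alike.\<close>
    then have "curve_length \<gamma> s x \<le> dist (\<gamma> s) (\<gamma> x) + e/2" if "a \<le> s" "s \<le> x" for s
      using that e by (cases "s = x") auto
    then show ?thesis by (intro exI[of _ 1]) auto
  qed
  have right: "\<exists>r>0. \<forall>s. x \<le> s \<and> s \<le> b \<and> s - x < r \<longrightarrow> curve_length \<gamma> x s \<le> dist (\<gamma> x) (\<gamma> s) + e/2"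
  proof (cases "x < b")
    case True
    from curve_length_initial_piece[OF bdd' True, of "e/2"] x e
    obtain c where c: "x < c" "c \<le> b" "\<And>s. x \<le> s \<Longrightarrow> s \<le> c \<Longrightarrow> curve_length \<gamma> x s \<le> dist (\<gamma> x) (\<gamma> s) + e/2"
      by auto
    then show ?thesis by (intro exI[of _ "c - x"]) auto
  next
    case False
    then have "curve_length \<gamma> x s \<le> dist (\<gamma> x) (\<gamma> s) + e/2" if "x \<le> s" "s \<le> b" for s
      using that e by (cases "s = x") auto
    then show ?thesis by (intro exI[of _ 1]) auto
  qed
  obtain l where l: "l > 0" "\<And>s. \<lbrakk>a \<le> s; s \<le> x; x - s < l\<rbrakk> \<Longrightarrow> curve_length \<gamma> s x \<le> dist (\<gamma> s) (\<gamma> x) + e/2"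
    using left by blast
  obtain r where r: "r > 0" "\<And>s. \<lbrakk>x \<le> s; s \<le> b; s - x < r\<rbrakk> \<Longrightarrow> curve_length \<gamma> x s \<le> dist (\<gamma> x) (\<gamma> s) + e/2"
    using right by blast
  show "\<exists>d>0. \<forall>s\<in>{a..b}. dist s x < d \<longrightarrow> dist (curve_length \<gamma> a s) (curve_length \<gamma> a x) < e"
  proof (intro exI[of _ "min d (min l r)"] conjI ballI impI)
    fix s assume s: "s \<in> {a..b}" "dist s x < min d (min l r)"
    have "dist (\<gamma> s) (\<gamma> x) < e/2" using d s by auto
    then show "dist (curve_length \<gamma> a s) (curve_length \<gamma> a x) < e"
      using l(2)[of s] r(2)[of s] add[of s x] add[of x s] nn[of s x] nn[of x s] s x
      by (cases "s \<le> x") (auto simp: dist_real_def dist_commute)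
  qed (use d l r in auto)
qed

section \<open>Lipschitz images and rectifiability\<close>

text \<open>The same partition serves for \<open>T\<close>, since each chord is stretched by at most
  \<open>L\<close>.\<close>

lemma chord_sums_lipschitz_image:
  assumes "S \<in> chord_sums (f \<circ> \<gamma>) a b" "L-lipschitz_on (\<gamma> ` {a..b}) f"
  shows "\<exists>T \<in> chord_sums \<gamma> a b. S \<le> L * T"
proof -
  have "x \<le> b \<Longrightarrow> \<exists>T \<in> chord_sums \<gamma> a x. S \<le> L * T" if "S \<in> chord_sums (f \<circ> \<gamma>) a x" for S x
    using that
  proof (induction rule: chord_sums_induct)
    case start
    show ?case by (rule bexI[OF _ chord_sums_start]) simp
  next
    case (step S y z)
    then obtain T where T: "T \<in> chord_sums \<gamma> a y" "S \<le> L * T" by auto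
    have "dist (f (\<gamma> y)) (f (\<gamma> z)) \<le> L * dist (\<gamma> y) (\<gamma> z)"
      using step by (intro lipschitz_onD[OF assms(2)]) auto
    then show ?case
      using T step by (intro bexI[OF _ chord_sums_step[OF T(1)]]) (auto simp: algebra_simps)
  qed
  then show ?thesis using assms by auto
qed

lemma bdd_above_chord_sums_lipschitz_image:
  assumes "bdd_above (chord_sums \<gamma> a b)" "L-lipschitz_on (\<gamma> ` {a..b}) f"
  shows "bdd_above (chord_sums (f \<circ> \<gamma>) a b)"
proof (rule bdd_aboveI)
  fix S assume "S \<in> chord_sums (f \<circ> \<gamma>) a b"
  from chord_sums_lipschitz_image[OF this assms(2)]
  obtain T where "T \<in> chord_sums \<gamma> a b" "S \<le> L * T" by blast
  then show "S \<le> L * curve_length \<gamma> a b"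
    using curve_length_ge[OF assms(1)] lipschitz_on_nonneg[OF assms(2)]
    by (meson mult_left_mono order_trans)
qed

lemma curve_length_lipschitz_image:
  assumes "bdd_above (chord_sums \<gamma> a b)" "L-lipschitz_on (\<gamma> ` {a..b}) f" "a \<le> b"
  shows "curve_length (f \<circ> \<gamma>) a b \<le> L * curve_length \<gamma> a b"
proof (rule curve_length_le[OF assms(3)])
  fix S assume "S \<in> chord_sums (f \<circ> \<gamma>) a b"
  from chord_sums_lipschitz_image[OF this assms(2)]
  obtain T where "T \<in> chord_sums \<gamma> a b" "S \<le> L * T" by blast
  then show "S \<le> L * curve_length \<gamma> a b"
    using curve_length_ge[OF assms(1)] lipschitz_on_nonneg[OF assms(2)]
    by (meson mult_left_mono order_trans)
qed

lemma rectifiable_path_lipschitz_image: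
  assumes "rectifiable_path \<gamma>" "L-lipschitz_on (path_image \<gamma>) f"
  shows "rectifiable_path (f \<circ> \<gamma>)"
  using assms lipschitz_on_continuous_on[OF assms(2)]
  by (auto simp: rectifiable_path_def path_image_def
      intro: path_continuous_image bdd_above_chord_sums_lipschitz_image)

lemma rectifiable_path_lipschitz:
  fixes \<gamma> :: "real \<Rightarrow> 'a::metric_space"
  assumes "K-lipschitz_on {0..1} \<gamma>"
  shows "rectifiable_path \<gamma>"
proof -
  have "x \<le> 1 \<Longrightarrow> S \<le> K * x" if "S \<in> chord_sums \<gamma> 0 x" for S x
    using that
  proof (induction rule: chord_sums_induct)
    case (step S y z)
    have "dist (\<gamma> y) (\<gamma> z) \<le> K * dist y z"
      using step by (intro lipschitz_onD[OF assms]) auto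
    then show ?case using step by (auto simp: dist_real_def algebra_simps)
  qed simp
  then show ?thesis
    using lipschitz_on_continuous_on[OF assms]
    unfolding rectifiable_path_def path_def bdd_above_def by auto
qed

text \<open>The derivative is bounded on the compact interval, so \<open>g\<close> is Lipschitz
  there. Polynomial paths later ensure that the infimum defining \<open>quasihyperbolic_dist\<close>
  runs over a nonempty set.\<close>

lemma rectifiable_path_polynomial_function:
  fixes g :: "real \<Rightarrow> 'a::euclidean_space"
  assumes "polynomial_function g"
  shows "rectifiable_path g"
proof -
  obtain g' where g': "polynomial_function g'" "\<And>x. (g has_vector_derivative g' x) (at x)"
    using has_vector_derivative_polynomial_function[OF assms] by blast
  have "compact (g' ` {0..1})"
    using continuous_on_polymonial_function[OF g'(1)] by (intro compact_continuous_image) auto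
  then obtain K where K: "K > 0" "\<And>x. x \<in> {0..1} \<Longrightarrow> norm (g' x) \<le> K"
    using compact_imp_bounded bounded_pos by (metis imageI)
  have "norm (g x - g y) \<le> K * norm (x - y)" if "x \<in> {0..1}" "y \<in> {0..1}" for x y
  proof (rule differentiable_bound[of "{0..1}" g "\<lambda>x h. h *\<^sub>R g' x"])
    show "(g has_derivative (\<lambda>h. h *\<^sub>R g' x)) (at x within {0..1})" for x
      using g'(2)[of x] by (simp add: has_vector_derivative_def has_derivative_at_withinI)
    show "onorm (\<lambda>h. h *\<^sub>R g' x) \<le> K" if "x \<in> {0..1}" for x
      using K(2)[OF that] by (intro onorm_le) (simp add: mult.commute[of K] mult_left_mono)
  qed (use that in auto)
  then have "K-lipschitz_on {0..1} g"
    using K by (intro lipschitz_onI) (auto simp: dist_norm)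
  then show ?thesis by (rule rectifiable_path_lipschitz)
qed

section \<open>Arc length integrals\<close>

lemma curve_length_mono:
  assumes "rectifiable_path \<gamma>" "0 \<le> s" "s \<le> t" "t \<le> 1"
  shows "curve_length \<gamma> 0 t = curve_length \<gamma> 0 s + curve_length \<gamma> s t"
    "dist (\<gamma> s) (\<gamma> t) \<le> curve_length \<gamma> s t"
    "curve_length \<gamma> 0 s \<le> curve_length \<gamma> 0 t"
proof -
  have bdd: "bdd_above (chord_sums \<gamma> a b)" if "0 \<le> a" "b \<le> 1" for a b
    using assms(1) that by (auto simp: rectifiable_path_def intro: bdd_above_chord_sums_subinterval)
  show 1: "curve_length \<gamma> 0 t = curve_length \<gamma> 0 s + curve_length \<gamma> s t"
    using assms by (intro curve_length_add bdd) auto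
  show 2: "dist (\<gamma> s) (\<gamma> t) \<le> curve_length \<gamma> s t"
    using assms by (intro dist_le_curve_length bdd) auto
  show "curve_length \<gamma> 0 s \<le> curve_length \<gamma> 0 t"
    using 1 2 zero_le_dist[of "\<gamma> s" "\<gamma> t"] by linarith
qed

text \<open>Intermediate value theorem for the continuous length function, so that the
  \<open>SOME\<close> in \<open>arclength_param\<close> always has a witness.\<close>

lemma curve_length_surj:
  assumes "rectifiable_path \<gamma>" "s \<in> {0..curve_length \<gamma> 0 1}"
  obtains t where "t \<in> {0..1}" "curve_length \<gamma> 0 t = s"
proof -
  have "continuous_on {0..1} (curve_length \<gamma> 0)"
    using assms(1) by (intro continuous_on_curve_length) (auto simp: rectifiable_path_def path_def)
  then show ?thesis
    using IVT'[of "curve_length \<gamma> 0" 0 s 1] assms(2) that by auto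
qed

lemma dist_le_curve_length_diff:
  assumes "rectifiable_path \<gamma>" "s \<in> {0..1}" "t \<in> {0..1}"
  shows "dist (\<gamma> s) (\<gamma> t) \<le> \<bar>curve_length \<gamma> 0 s - curve_length \<gamma> 0 t\<bar>"
  using curve_length_mono[OF assms(1), of s t] curve_length_mono[OF assms(1), of t s] assms(2,3)
  by (cases "s \<le> t") (auto simp: dist_commute)

text \<open>The parameter picked by \<open>SOME\<close> may differ from \<open>t\<close>, but equal
  arc lengths force the points of the path to have distance 0.\<close>

lemma arclength_param_curve_length:
  assumes "rectifiable_path \<gamma>" "t \<in> {0..1}"
  shows "arclength_param \<gamma> (curve_length \<gamma> 0 t) = \<gamma> t"
proof -
  define t' where "t' = (SOME u. u \<in> {0..1} \<and> curve_length \<gamma> 0 u = curve_length \<gamma> 0 t)"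
  have "t' \<in> {0..1} \<and> curve_length \<gamma> 0 t' = curve_length \<gamma> 0 t"
    unfolding t'_def by (rule someI[of _ t]) (use assms in auto)
  then show ?thesis
    using dist_le_curve_length_diff[OF assms(1), of t' t] assms(2)
    by (simp add: arclength_param_def t'_def)
qed

lemma arclength_param_in_path_image:
  assumes "rectifiable_path \<gamma>" "s \<in> {0..curve_length \<gamma> 0 1}"
  shows "arclength_param \<gamma> s \<in> path_image \<gamma>"
  using curve_length_surj[OF assms] arclength_param_curve_length[OF assms(1)]
  by (metis imageI path_image_def)

text \<open>The parametrization is 1-Lipschitz, because a chord is no longer than its arc.\<close>

lemma continuous_on_arclength_param:
  assumes "rectifiable_path \<gamma>"
  shows "continuous_on {0..curve_length \<gamma> 0 1} (arclength_param \<gamma>)"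
proof (rule lipschitz_on_continuous_on[OF lipschitz_onI])
  fix s s' assume "s \<in> {0..curve_length \<gamma> 0 1}" "s' \<in> {0..curve_length \<gamma> 0 1}"
  then obtain t t' where "t \<in> {0..1}" "curve_length \<gamma> 0 t = s" "t' \<in> {0..1}" "curve_length \<gamma> 0 t' = s'"
    using curve_length_surj[OF assms] by metis
  then show "dist (arclength_param \<gamma> s) (arclength_param \<gamma> s') \<le> 1 * dist s s'"
    using dist_le_curve_length_diff[OF assms, of t t'] arclength_param_curve_length[OF assms]
    by (auto simp: dist_real_def)
qed simp

lemma continuous_on_comp_arclength_param:
  fixes \<rho> :: "'a::metric_space \<Rightarrow> real"
  assumes "rectifiable_path \<gamma>" "continuous_on (path_image \<gamma>) \<rho>"
  shows "continuous_on {0..curve_length \<gamma> 0 1} (\<lambda>s. \<rho> (arclength_param \<gamma> s))"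
  using arclength_param_in_path_image[OF assms(1)]
  by (intro continuous_on_compose2[OF assms(2) continuous_on_arclength_param[OF assms(1)]]) auto

section \<open>Substitution inequality for integrals\<close>

text \<open>A mean value inequality without derivatives. On a short interval \<open>q\<close> is
  nearly constant, so \<open>q r\<close> can be traded for the integral at a cost of
  \<open>e\<close> per unit length; bisection glues the local estimates, and \<open>e\<close> is
  arbitrary.\<close>

lemma increment_le_integral:
  fixes D q :: "real \<Rightarrow> real"
  assumes "a \<le> b" and q: "continuous_on {a..b} q"
    and D: "\<And>s t. \<lbrakk>a \<le> s; s \<le> t; t \<le> b\<rbrakk> \<Longrightarrow> \<exists>r\<in>{s..t}. D t - D s \<le> (t - s) * q r"
  shows "D b - D a \<le> integral {a..b} q"
proof -
  have int: "q integrable_on {s..t}" if "a \<le> s" "t \<le> b" for s t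
    using that by (intro integrable_continuous_interval continuous_on_subset[OF q]) auto
  have eps: "D b - D a \<le> integral {a..b} q + e * (b - a)" if e: "e > 0" for e
  proof -
    \<comment> \<open>The premise inside \<open>P\<close> is there because the local part of
      \<open>Bolzano\<close> also considers intervals that stick out of
      \<open>[a, b]\<close>.\<close>
    define P where "P s t \<longleftrightarrow> (a \<le> s \<and> s \<le> t \<and> t \<le> b \<longrightarrow> D t - D s \<le> integral {s..t} q + e * (t - s))" for s t
    have "P a b" using \<open>a \<le> b\<close>
    proof (induction rule: Bolzano)
      case (trans s r t)
      show ?case unfolding P_def
      proof
        assume *: "a \<le> s \<and> s \<le> t \<and> t \<le> b"
        then have "integral {s..r} q + integral {r..t} q = integral {s..t} q"
          using trans by (intro Henstock_Kurzweil_Integration.integral_combine int) auto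
        then show "D t - D s \<le> integral {s..t} q + e * (t - s)"
          using trans * unfolding P_def by (auto simp: algebra_simps)
      qed
    next
      case (local x)
      obtain d where d: "d > 0" "\<And>s. s \<in> {a..b} \<Longrightarrow> dist s x < d \<Longrightarrow> dist (q s) (q x) < e/2"
        using q local e unfolding continuous_on_iff by (metis atLeastAtMost_iff half_gt_zero)
      have "D t - D s \<le> integral {s..t} q + e * (t - s)"
        if "s \<le> x" "x \<le> t" "t - s < d" "a \<le> s" "t \<le> b" for s t
      proof -
        obtain r where r: "r \<in> {s..t}" "D t - D s \<le> (t - s) * q r"
          using D[of s t] \<open>s \<le> x\<close> \<open>x \<le> t\<close> \<open>a \<le> s\<close> \<open>t \<le> b\<close> by auto
        have qr: "q r - e \<le> q v" if "v \<in> {s..t}" for v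
        proof -
          have "w \<in> {a..b} \<and> dist w x < d" if "w \<in> {s..t}" for w
            using that \<open>s \<le> x\<close> \<open>x \<le> t\<close> \<open>t - s < d\<close> \<open>a \<le> s\<close> \<open>t \<le> b\<close> by (auto simp: dist_real_def)
          then have "dist (q v) (q x) < e/2" "dist (q r) (q x) < e/2"
            using d(2) r(1) that by blast+
          then show ?thesis unfolding dist_real_def by linarith
        qed
        have "integral {s..t} (\<lambda>_. q r - e) \<le> integral {s..t} q"
          using qr \<open>a \<le> s\<close> \<open>t \<le> b\<close> by (intro integral_le int) auto
        then show ?thesis using r(2) \<open>s \<le> x\<close> \<open>x \<le> t\<close> by (simp add: algebra_simps)
      qed
      then show ?case using d(1) unfolding P_def by auto
    qed
    then show ?thesis using \<open>a \<le> b\<close> by (simp add: P_def)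
  qed
  show ?thesis
  proof (rule field_le_epsilon)
    fix e :: real assume "e > 0"
    \<comment> \<open>The summand 1 keeps the denominator positive when
      \<open>a = b\<close>.\<close>
    moreover have "e / (b - a + 1) * (b - a) \<le> e"
      using \<open>a \<le> b\<close> \<open>e > 0\<close> by (simp add: field_simps)
    ultimately show "D b - D a \<le> integral {a..b} q + e"
      using eps[of "e / (b - a + 1)"] \<open>a \<le> b\<close> by simp
  qed
qed

text \<open>Here \<open>D s\<close> is the integral of \<open>p\<close> from \<open>u a\<close> to
  \<open>u s\<close>. By the intermediate value theorem, \<open>p\<close> on
  \<open>{u s..u t}\<close> is bounded by the maximum \<open>p (u r)\<close> of \<open>p\<close>
  along \<open>u\<close> on \<open>{s..t}\<close>, and that interval has length at most
  \<open>L * (t - s)\<close>.\<close>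

lemma integral_le_lipschitz_substitution:
  fixes u p :: "real \<Rightarrow> real"
  assumes "a \<le> b" and mono: "\<And>s t. \<lbrakk>a \<le> s; s \<le> t; t \<le> b\<rbrakk> \<Longrightarrow> u s \<le> u t"
    and lip: "L-lipschitz_on {a..b} u"
    and p: "continuous_on {u a..u b} p" "\<And>v. v \<in> {u a..u b} \<Longrightarrow> 0 \<le> p v"
  shows "integral {u a..u b} p \<le> L * integral {a..b} (\<lambda>s. p (u s))"
proof -
  have cu: "continuous_on {a..b} u" using lip by (rule lipschitz_on_continuous_on)
  have cpu: "continuous_on {a..b} (\<lambda>s. p (u s))"
    using mono by (intro continuous_on_compose2[OF p(1) cu]) auto
  have int: "p integrable_on {s..t}" if "u a \<le> s" "t \<le> u b" for s t
    using that by (intro integrable_continuous_interval continuous_on_subset[OF p(1)]) auto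
  \<comment> \<open>The vanishing second integral only gives the claim the shape
    \<open>D b - D a\<close>.\<close>
  have "integral {u a..u b} p - integral {u a..u a} p \<le> integral {a..b} (\<lambda>s. L * p (u s))"
  proof (rule increment_le_integral[OF \<open>a \<le> b\<close>])
    show "continuous_on {a..b} (\<lambda>s. L * p (u s))" by (intro continuous_intros cpu)
    fix s t assume st: "a \<le> s" "s \<le> t" "t \<le> b"
    have le: "u a \<le> u s" "u s \<le> u t" "u t \<le> u b" using mono st by auto
    have "continuous_on {s..t} (\<lambda>s. p (u s))" using st by (intro continuous_on_subset[OF cpu]) auto
    then obtain r where r: "r \<in> {s..t}" "\<And>r'. r' \<in> {s..t} \<Longrightarrow> p (u r') \<le> p (u r)"
      using continuous_attains_sup[of "{s..t}" "\<lambda>s. p (u s)"] st by auto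
    have "integral {u s..u t} p \<le> integral {u s..u t} (\<lambda>_. p (u r))"
    proof (rule integral_le)
      show "p integrable_on {u s..u t}" using le by (intro int)
      fix v assume v: "v \<in> {u s..u t}"
      have "continuous_on {s..t} u" using st by (intro continuous_on_subset[OF cu]) auto
      then obtain r' where "r' \<in> {s..t}" "u r' = v"
        using IVT'[of u s v t] v st by auto
      then show "p v \<le> p (u r)" using r by auto
    qed (rule integrable_const_ivl)
    also have "\<dots> = (u t - u s) * p (u r)" using le by simp
    also have "\<dots> \<le> (L * (t - s)) * p (u r)"
    proof (rule mult_right_mono)
      show "u t - u s \<le> L * (t - s)"
        using lipschitz_onD[OF lip, of s t] st by (auto simp: dist_real_def)
      show "0 \<le> p (u r)" using mono st r by (intro p) auto
    qed
    finally have "integral {u s..u t} p \<le> (t - s) * (L * p (u r))" by (simp add: mult_ac)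
    moreover have "integral {u a..u s} p + integral {u s..u t} p = integral {u a..u t} p"
      using le by (intro Henstock_Kurzweil_Integration.integral_combine int) auto
    ultimately show "\<exists>r\<in>{s..t}. integral {u a..u t} p - integral {u a..u s} p \<le> (t - s) * (L * p (u r))"
      by (intro bexI[OF _ r(1)]) linarith
  qed
  then show ?thesis by simp
qed

lemma arclength_integral_lipschitz_image:
  fixes \<gamma> :: "real \<Rightarrow> 'a::metric_space" and f :: "'a \<Rightarrow> 'b::metric_space"
  assumes rect: "rectifiable_path \<gamma>" and lip: "L-lipschitz_on (path_image \<gamma>) f"
    and \<rho>: "continuous_on (path_image (f \<circ> \<gamma>)) \<rho>" "\<And>z. z \<in> path_image (f \<circ> \<gamma>) \<Longrightarrow> 0 \<le> \<rho> z"
  shows "arclength_integral (f \<circ> \<gamma>) \<rho> \<le> L * arclength_integral \<gamma> (\<rho> \<circ> f)"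
proof -
  have rect': "rectifiable_path (f \<circ> \<gamma>)" using rect lip by (rule rectifiable_path_lipschitz_image)
  define \<sigma> where "\<sigma> = curve_length \<gamma> 0"
  define \<tau> where "\<tau> = curve_length (f \<circ> \<gamma>) 0"
  have \<tau>\<sigma>: "\<tau> t - \<tau> s \<le> L * (\<sigma> t - \<sigma> s)" if "0 \<le> s" "s \<le> t" "t \<le> 1" for s t
  proof -
    have "bdd_above (chord_sums \<gamma> s t)"
      using rect that by (auto simp: rectifiable_path_def intro: bdd_above_chord_sums_subinterval)
    moreover have "L-lipschitz_on (\<gamma> ` {s..t}) f"
      using that by (intro lipschitz_on_subset[OF lip]) (auto simp: path_image_def)
    ultimately have "curve_length (f \<circ> \<gamma>) s t \<le> L * curve_length \<gamma> s t"
      using \<open>s \<le> t\<close> by (rule curve_length_lipschitz_image)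
    then show ?thesis
      using curve_length_mono(1)[OF rect that] curve_length_mono(1)[OF rect' that]
      by (simp add: \<sigma>_def \<tau>_def)
  qed
  have mono: "\<sigma> s \<le> \<sigma> t" "\<tau> s \<le> \<tau> t" if "0 \<le> s" "s \<le> t" "t \<le> 1" for s t
    using curve_length_mono(3)[OF rect that] curve_length_mono(3)[OF rect' that]
    by (auto simp: \<sigma>_def \<tau>_def)
  have abs: "\<bar>\<tau> s - \<tau> t\<bar> \<le> L * \<bar>\<sigma> s - \<sigma> t\<bar>" if "s \<in> {0..1}" "t \<in> {0..1}" for s t
    using \<tau>\<sigma>[of s t] \<tau>\<sigma>[of t s] mono[of s t] mono[of t s] that by (cases "s \<le> t") auto
  have "\<forall>s\<in>{0..\<sigma> 1}. \<exists>t. t \<in> {0..1} \<and> \<sigma> t = s"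
    \<comment> \<open>\<open>T\<close> selects a parameter for each arc length of
      \<open>\<gamma>\<close>; no monotonicity of \<open>T\<close> is claimed.\<close>
    unfolding \<sigma>_def using curve_length_surj[OF rect] by blast
  from bchoice[OF this] obtain T where T: "\<And>s. s \<in> {0..\<sigma> 1} \<Longrightarrow> T s \<in> {0..1} \<and> \<sigma> (T s) = s"
    by blast
  define u where "u s = \<tau> (T s)" for s
  \<comment> \<open>Independence of the selection: by \<open>abs\<close>, parameters with equal
    \<open>\<sigma>\<close> have equal \<open>\<tau>\<close>.\<close>
  have u\<sigma>: "u (\<sigma> t) = \<tau> t" if "t \<in> {0..1}" for t
  proof -
    have "\<sigma> t \<in> {0..\<sigma> 1}" using mono(1)[of 0 t] mono(1)[of t 1] that by (simp add: \<sigma>_def)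
    from T[OF this] show ?thesis using abs[of "T (\<sigma> t)" t] that by (simp add: u_def)
  qed
  have \<sigma>01: "0 \<le> \<sigma> 1" using mono(1)[of 0 1] by (simp add: \<sigma>_def)
  have u0: "u 0 = 0" and u1: "u (\<sigma> 1) = \<tau> 1"
    using u\<sigma>[of 0] u\<sigma>[of 1] by (auto simp: \<sigma>_def \<tau>_def)
  let ?p = "\<lambda>s. \<rho> (arclength_param (f \<circ> \<gamma>) s)"
  have "integral {u 0..u (\<sigma> 1)} ?p \<le> L * integral {0..\<sigma> 1} (\<lambda>s. ?p (u s))"
  proof (rule integral_le_lipschitz_substitution[OF \<sigma>01])
    show "u s \<le> u t" if "0 \<le> s" "s \<le> t" "t \<le> \<sigma> 1" for s t
    proof (cases "T s \<le> T t")
      case True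
      then show ?thesis using T[of s] T[of t] that mono(2) by (auto simp: u_def)
    next
      case False
      \<comment> \<open>Monotonicity of \<open>\<sigma>\<close> turns \<open>T t < T s\<close> into
        \<open>t \<le> s\<close>, which leaves only \<open>s = t\<close>.\<close>
      then have "t \<le> s" using T[of s] T[of t] that mono(1)[of "T t" "T s"] by auto
      then show ?thesis using that by simp
    qed
    show "L-lipschitz_on {0..\<sigma> 1} u"
    proof (rule lipschitz_onI)
      fix s t assume "s \<in> {0..\<sigma> 1}" "t \<in> {0..\<sigma> 1}"
      then show "dist (u s) (u t) \<le> L * dist s t"
        using T[of s] T[of t] abs[of "T s" "T t"] by (auto simp: u_def dist_real_def)
    qed (rule lipschitz_on_nonneg[OF lip])
    show "continuous_on {u 0..u (\<sigma> 1)} ?p"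
      using continuous_on_comp_arclength_param[OF rect' \<rho>(1)] by (simp add: u0 u1 \<tau>_def)
    show "0 \<le> ?p v" if "v \<in> {u 0..u (\<sigma> 1)}" for v
      using that by (intro \<rho> arclength_param_in_path_image rect') (simp add: u0 u1 \<tau>_def)
  qed
  \<comment> \<open>Both parametrizations are evaluated at the common path parameter
    \<open>T s\<close>.\<close>
  also have "integral {0..\<sigma> 1} (\<lambda>s. ?p (u s)) = integral {0..\<sigma> 1} (\<lambda>s. (\<rho> \<circ> f) (arclength_param \<gamma> s))"
  proof (rule integral_cong)
    fix s assume "s \<in> {0..\<sigma> 1}"
    then show "?p (u s) = (\<rho> \<circ> f) (arclength_param \<gamma> s)"
      using T[of s] arclength_param_curve_length[OF rect, of "T s"]
        arclength_param_curve_length[OF rect', of "T s"]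
      by (auto simp: u_def \<sigma>_def \<tau>_def)
  qed
  finally show ?thesis
    unfolding arclength_integral_def u0 u1 by (simp only: \<sigma>_def \<tau>_def)
qed

lemma arclength_integral_mono:
  assumes "rectifiable_path \<gamma>" "continuous_on (path_image \<gamma>) \<rho>" "continuous_on (path_image \<gamma>) \<rho>'"
    and "\<And>z. z \<in> path_image \<gamma> \<Longrightarrow> \<rho> z \<le> \<rho>' z"
  shows "arclength_integral \<gamma> \<rho> \<le> arclength_integral \<gamma> \<rho>'"
  unfolding arclength_integral_def using assms arclength_param_in_path_image[OF assms(1)]
  by (intro integral_le integrable_continuous_interval continuous_on_comp_arclength_param) auto

lemma arclength_integral_cmult:
  "arclength_integral \<gamma> (\<lambda>z. c * \<rho> z) = c * arclength_integral \<gamma> \<rho>"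
  by (simp add: arclength_integral_def)

lemma arclength_integral_nonneg:
  assumes "rectifiable_path \<gamma>" "continuous_on (path_image \<gamma>) \<rho>"
    and "\<And>z. z \<in> path_image \<gamma> \<Longrightarrow> 0 \<le> \<rho> z"
  shows "0 \<le> arclength_integral \<gamma> \<rho>"
  using arclength_integral_mono[OF assms(1) continuous_on_const assms(2), of 0] assms(3)
  by (simp add: arclength_integral_def)

section \<open>Domains and bilipschitz maps\<close>

text \<open>An open set misses its closed frontier. That the frontier is nonempty matters, since
  \<open>infdist\<close> to the empty set is 0.\<close>

lemma boundary_dist_pos:
  assumes "open G" "G \<noteq> UNIV" "x \<in> G"
  shows "0 < boundary_dist G x"
  unfolding boundary_dist_def using assms frontier_not_empty[of G]
  by (intro infdist_pos_not_in_closed) (auto simp: frontier_def interior_open)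

lemma continuous_on_inverse_boundary_dist:
  assumes "open G" "G \<noteq> UNIV"
  shows "continuous_on G (\<lambda>z. 1 / boundary_dist G z)"
proof -
  have "boundary_dist G z \<noteq> 0" if "z \<in> G" for z
    using boundary_dist_pos[OF assms that] by simp
  moreover have "continuous_on G (boundary_dist G)"
    unfolding boundary_dist_def by (intro continuous_intros)
  ultimately show ?thesis by (intro continuous_intros) auto
qed

text \<open>The integrals are bounded below by 0, as a real infimum requires in order to be a lower
  bound.\<close>

lemma quasihyperbolic_dist_le:
  assumes "open G" "G \<noteq> UNIV" "rectifiable_path \<gamma>" "path_image \<gamma> \<subseteq> G"
  shows "quasihyperbolic_dist G (pathstart \<gamma>) (pathfinish \<gamma>)
    \<le> arclength_integral \<gamma> (\<lambda>z. 1 / boundary_dist G z)"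
  unfolding quasihyperbolic_dist_def
proof (rule cINF_lower[OF bdd_belowI2])
  fix \<eta> assume "\<eta> \<in> {\<eta>. rectifiable_path \<eta> \<and> path_image \<eta> \<subseteq> G \<and> pathstart \<eta> = pathstart \<gamma>
      \<and> pathfinish \<eta> = pathfinish \<gamma>}"
  then have "rectifiable_path \<eta>" "path_image \<eta> \<subseteq> G" by auto
  then show "0 \<le> arclength_integral \<eta> (\<lambda>z. 1 / boundary_dist G z)"
    using continuous_on_inverse_boundary_dist[OF assms(1,2)] boundary_dist_pos[OF assms(1,2)]
    by (intro arclength_integral_nonneg) (auto intro: continuous_on_subset simp: less_imp_le subset_iff)
qed (use assms in auto)

text \<open>This direction needs a competing path; a polynomial one joins any two points of a
  connected open set.\<close>

lemma le_quasihyperbolic_dist: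
  assumes "open G" "connected G" "x \<in> G" "y \<in> G"
    and "\<And>\<gamma>. \<lbrakk>rectifiable_path \<gamma>; path_image \<gamma> \<subseteq> G; pathstart \<gamma> = x; pathfinish \<gamma> = y\<rbrakk>
      \<Longrightarrow> m \<le> arclength_integral \<gamma> (\<lambda>z. 1 / boundary_dist G z)"
  shows "m \<le> quasihyperbolic_dist G x y"
  unfolding quasihyperbolic_dist_def
proof (rule cINF_greatest)
  show "{\<gamma>. rectifiable_path \<gamma> \<and> path_image \<gamma> \<subseteq> G \<and> pathstart \<gamma> = x \<and> pathfinish \<gamma> = y} \<noteq> {}"
    using connected_open_polynomial_connected[OF assms(1-4)] rectifiable_path_polynomial_function
    by blast
qed (use assms(5) in auto)

section \<open>Homeomorphisms of the half-line\<close>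

text \<open>A continuous injection on an interval is strictly monotone. A decreasing one would have
  its maximum at 0, yet surjectivity yields the value \<open>\<phi> 0 + 1\<close>.\<close>

lemma strict_mono_on_homeomorphism_nonneg:
  fixes \<phi> \<psi> :: "real \<Rightarrow> real"
  assumes "homeomorphism {0..} {0..} \<phi> \<psi>"
  shows "strict_mono_on {0..} \<phi>"
proof -
  have "inj_on \<phi> {0..}" "continuous_on {0..} \<phi>" and im: "\<phi> ` {0..} = {0..}"
    using assms by (auto simp: homeomorphism_def intro: inj_on_inverseI)
  moreover have "is_interval {0::real..}" by (simp add: is_interval_ci)
  ultimately have "strict_mono_on {0..} \<phi> \<or> strict_antimono_on {0..} \<phi>"
    using injective_eq_monotone_map by blast
  moreover have "\<not> strict_antimono_on {0..} \<phi>"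
  proof
    assume anti: "strict_antimono_on {0..} \<phi>"
    have "\<phi> 0 \<in> {0..}" using im by blast
    then have "\<phi> 0 + 1 \<in> \<phi> ` {0..}" unfolding im by simp
    then obtain t where "t \<ge> 0" "\<phi> t = \<phi> 0 + 1" by auto
    then show False
      using monotone_onD[OF anti, of 0 t] by (cases "t = 0") auto
  qed
  ultimately show ?thesis by blast
qed

lemma homeomorphism_nonneg_rescale:
  fixes \<phi> \<psi> :: "real \<Rightarrow> real"
  assumes h: "homeomorphism {0..} {0..} \<phi> \<psi>" and "c > 0"
  shows "homeomorphism {0..} {0..} (\<lambda>t. c * \<phi> (c * t)) (\<lambda>t. \<psi> (t / c) / c)"
proof (rule homeomorphismI)
  have im: "\<phi> t \<ge> 0" "\<psi> t \<ge> 0" if "t \<ge> 0" for t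
    using homeomorphism_image1[OF h] homeomorphism_image2[OF h] that by auto
  show "continuous_on {0..} (\<lambda>t. c * \<phi> (c * t))"
    using \<open>c > 0\<close> by (intro continuous_intros continuous_on_compose2[OF homeomorphism_cont1[OF h]]) auto
  show "continuous_on {0..} (\<lambda>t. \<psi> (t / c) / c)"
    using \<open>c > 0\<close> by (intro continuous_intros continuous_on_compose2[OF homeomorphism_cont2[OF h]]) auto
  show "(\<lambda>t. c * \<phi> (c * t)) ` {0..} \<subseteq> {0..}" "(\<lambda>t. \<psi> (t / c) / c) ` {0..} \<subseteq> {0..}"
    using \<open>c > 0\<close> by (auto intro!: mult_nonneg_nonneg divide_nonneg_nonneg im)
  show "\<psi> (c * \<phi> (c * t) / c) / c = t" if "t \<in> {0..}" for t
    using homeomorphism_apply1[OF h, of "c * t"] that \<open>c > 0\<close> by simp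
  show "c * \<phi> (c * (\<psi> (t / c) / c)) = t" if "t \<in> {0..}" for t
    using homeomorphism_apply2[OF h, of "t / c"] that \<open>c > 0\<close> by simp
qed

section \<open>Bilipschitz maps of Euclidean space\<close>

locale bilipschitz_map =
  fixes f :: "'a::euclidean_space \<Rightarrow> 'a" and L :: real
  assumes L_pos: "L > 0"
    and lower: "dist x y \<le> L * dist (f x) (f y)"
    and upper: "dist (f x) (f y) \<le> L * dist x y"
begin

lemma lipschitz_on: "L-lipschitz_on S f"
  using upper L_pos by (intro lipschitz_onI) auto

lemma continuous_on: "continuous_on S f"
  using lipschitz_on by (rule lipschitz_on_continuous_on)

lemma inj: "inj_on f S"
proof (rule inj_onI)
  fix x y assume "f x = f y"
  then show "x = y" using lower[of x y] by simp
qed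

text \<open>Source and target are the same space, so the dimensions agree as invariance of domain
  demands.\<close>

lemma open_image: "open S \<Longrightarrow> open (f ` S)"
  using continuous_on inj by (intro invariance_of_domain)

text \<open>By the lower bound, the preimages of a convergent sequence form a Cauchy sequence; its
  limit lies in \<open>S\<close> and is mapped to \<open>l\<close>.\<close>

lemma closed_image:
  assumes "closed S"
  shows "closed (f ` S)"
  unfolding closed_sequential_limits
proof (intro allI impI, elim conjE)
  fix X l assume X: "\<forall>n. X n \<in> f ` S" and lim: "X \<longlonglongrightarrow> l"
  have "\<forall>n. \<exists>w. w \<in> S \<and> X n = f w" using X by blast
  from choice[OF this] obtain z where z: "\<And>n. z n \<in> S" "\<And>n. X n = f (z n)" by blast
  have "Cauchy z"
    unfolding Cauchy_def
  proof (intro allI impI)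
    fix e :: real assume "e > 0"
    then have "e / L > 0" using L_pos by simp
    then obtain M where M: "\<And>m n. m \<ge> M \<Longrightarrow> n \<ge> M \<Longrightarrow> dist (X m) (X n) < e / L"
      using LIMSEQ_imp_Cauchy[OF lim] unfolding Cauchy_def by meson
    have "dist (z m) (z n) < e" if "m \<ge> M" "n \<ge> M" for m n
      using M[OF that] lower[of "z m" "z n"] L_pos by (simp add: z(2) field_simps)
    then show "\<exists>M. \<forall>m\<ge>M. \<forall>n\<ge>M. dist (z m) (z n) < e" by blast
  qed
  then obtain w where w: "z \<longlonglongrightarrow> w" using Cauchy_convergent convergent_def by blast
  have "w \<in> S" using closed_sequentially[OF assms] z(1) w by blast
  moreover have "(\<lambda>n. f (z n)) \<longlonglongrightarrow> f w"
    using continuous_on[of UNIV] w by (simp add: continuous_on_tendsto_compose)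
  then have "X \<longlonglongrightarrow> f w" by (simp flip: z(2))
  then have "l = f w" using lim LIMSEQ_unique by blast
  ultimately show "l \<in> f ` S" by blast
qed

text \<open>The range is nonempty, open and closed in a connected space.\<close>

lemma surj: "range f = UNIV"
  using open_image[of UNIV] closed_image[of UNIV] clopen[of "range f"] by auto

text \<open>\<open>f\<close> commutes with closures, being continuous and closed, and with set
  differences, being injective.\<close>

lemma frontier_image:
  assumes "open S"
  shows "frontier (f ` S) = f ` frontier S"
proof -
  have "closure (f ` S) = f ` closure S"
    using closed_image[of "closure S"] continuous_on[of "closure S"]
    by (intro antisym closure_minimal image_closure_subset) (auto simp: closure_subset image_mono)
  then show ?thesis
    using inj[of UNIV] by (simp add: frontier_def interior_open assms open_image image_set_diff)
qed

text \<open>The distance to a closed nonempty frontier is attained. The nearest frontier point on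
  either side corresponds under \<open>f\<close> to a competitor on the other side.\<close>

lemma boundary_dist_image:
  assumes "open G" "G \<noteq> {}" "G \<noteq> UNIV"
  shows "boundary_dist G x \<le> L * boundary_dist (f ` G) (f x)"
    and "boundary_dist (f ` G) (f x) \<le> L * boundary_dist G x"
proof -
  have ne: "frontier G \<noteq> {}" using assms frontier_not_empty by blast
  obtain w where w: "w \<in> frontier G" "boundary_dist G x = dist x w"
    unfolding boundary_dist_def by (rule infdist_attains_inf[OF frontier_closed ne])
  have "frontier (f ` G) \<noteq> {}" using ne by (simp add: frontier_image[OF assms(1)])
  then obtain v where "v \<in> frontier (f ` G)" "boundary_dist (f ` G) (f x) = dist (f x) v"
    unfolding boundary_dist_def by (rule infdist_attains_inf[OF frontier_closed])
  then obtain w' where w': "w' \<in> frontier G" "boundary_dist (f ` G) (f x) = dist (f x) (f w')"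
    unfolding frontier_image[OF assms(1)] by blast
  have "boundary_dist G x \<le> dist x w'" using w'(1) by (simp add: boundary_dist_def infdist_le)
  then show "boundary_dist G x \<le> L * boundary_dist (f ` G) (f x)" using lower[of x w'] w'(2) by simp
  have "boundary_dist (f ` G) (f x) \<le> dist (f x) (f w)"
    using w(1) by (simp add: boundary_dist_def infdist_le frontier_image[OF assms(1)])
  then show "boundary_dist (f ` G) (f x) \<le> L * boundary_dist G x" using upper[of x w] w(2) by simp
qed

lemma image_neq_UNIV: "G \<noteq> UNIV \<Longrightarrow> f ` G \<noteq> UNIV"
  using inj[of UNIV] surj by (metis inj_image_eq_iff)

text \<open>Each path \<open>\<gamma>\<close> in \<open>G\<close> is compared with
  \<open>f \<circ> \<gamma>\<close>: one factor \<open>L\<close> comes from arc length, the other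
  from the density. Dividing by \<open>L\<^sup>2\<close> turns the claim into a lower bound for an
  infimum.\<close>

lemma quasihyperbolic_dist_image_le:
  assumes G: "open G" "connected G" "G \<noteq> UNIV" and xy: "x \<in> G" "y \<in> G"
  shows "quasihyperbolic_dist (f ` G) (f x) (f y) \<le> L\<^sup>2 * quasihyperbolic_dist G x y"
proof -
  note G' = open_image[OF G(1)] image_neq_UNIV[OF G(3)]
  let ?\<rho> = "\<lambda>z. 1 / boundary_dist G z" and ?\<rho>' = "\<lambda>z. 1 / boundary_dist (f ` G) z"
  have "quasihyperbolic_dist (f ` G) (f x) (f y) / L\<^sup>2 \<le> quasihyperbolic_dist G x y"
  proof (rule le_quasihyperbolic_dist[OF G(1,2) xy])
    fix \<gamma> assume \<gamma>: "rectifiable_path \<gamma>" "path_image \<gamma> \<subseteq> G" "pathstart \<gamma> = x" "pathfinish \<gamma> = y"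
    have rect: "rectifiable_path (f \<circ> \<gamma>)"
      using \<gamma>(1) lipschitz_on by (rule rectifiable_path_lipschitz_image)
    have im: "path_image (f \<circ> \<gamma>) \<subseteq> f ` G" using \<gamma>(2) by (auto simp: path_image_compose)
    have cont': "continuous_on (f ` G) ?\<rho>'" using G' by (rule continuous_on_inverse_boundary_dist)
    have cont: "continuous_on G ?\<rho>" using G(1,3) by (rule continuous_on_inverse_boundary_dist)
    have "quasihyperbolic_dist (f ` G) (f x) (f y) \<le> arclength_integral (f \<circ> \<gamma>) ?\<rho>'"
      using quasihyperbolic_dist_le[OF G' rect im] \<gamma>(3,4) by (simp add: pathstart_compose pathfinish_compose)
    also have "\<dots> \<le> L * arclength_integral \<gamma> (?\<rho>' \<circ> f)"
    proof (rule arclength_integral_lipschitz_image[OF \<gamma>(1) lipschitz_on])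
      show "0 \<le> ?\<rho>' z" for z by (simp add: boundary_dist_def infdist_nonneg)
    qed (rule continuous_on_subset[OF cont' im])
    also have "\<dots> \<le> L * arclength_integral \<gamma> (\<lambda>z. L * ?\<rho> z)"
    proof (intro mult_left_mono arclength_integral_mono \<gamma>(1))
      show "continuous_on (path_image \<gamma>) (?\<rho>' \<circ> f)"
        using \<gamma>(2) by (intro continuous_on_compose continuous_on continuous_on_subset[OF cont']) auto
      show "continuous_on (path_image \<gamma>) (\<lambda>z. L * ?\<rho> z)"
        by (intro continuous_on_mult_left continuous_on_subset[OF cont \<gamma>(2)])
      fix z assume "z \<in> path_image \<gamma>"
      then have z: "z \<in> G" using \<gamma>(2) by auto
      have "0 < boundary_dist G z" "0 < boundary_dist (f ` G) (f z)"
        using boundary_dist_pos[OF G(1,3) z] boundary_dist_pos[OF G', of "f z"] z by auto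
      moreover have "boundary_dist G z \<le> L * boundary_dist (f ` G) (f z)"
        using G z by (intro boundary_dist_image) auto
      ultimately show "(?\<rho>' \<circ> f) z \<le> L * ?\<rho> z" by (simp add: field_simps)
    qed (use L_pos in simp)
    also have "\<dots> = L\<^sup>2 * arclength_integral \<gamma> ?\<rho>"
      by (simp only: arclength_integral_cmult power2_eq_square mult.assoc)
    finally show "quasihyperbolic_dist (f ` G) (f x) (f y) / L\<^sup>2 \<le> arclength_integral \<gamma> ?\<rho>"
      using L_pos by (simp add: field_simps)
  qed
  then show ?thesis using L_pos by (simp add: field_simps)
qed

text \<open>The numerator contributes one factor \<open>L\<close> through the lower bound on
  \<open>f\<close>, the denominator another through the distances to the boundary.\<close>

lemma relative_dist_image_ge:
  assumes G: "open G" "G \<noteq> UNIV" and xy: "x \<in> G" "y \<in> G"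
  shows "dist x y / min (boundary_dist G x) (boundary_dist G y)
    \<le> L\<^sup>2 * (dist (f x) (f y) / min (boundary_dist (f ` G) (f x)) (boundary_dist (f ` G) (f y)))"
proof -
  let ?m = "min (boundary_dist G x) (boundary_dist G y)"
  let ?m' = "min (boundary_dist (f ` G) (f x)) (boundary_dist (f ` G) (f y))"
  have pos: "0 < ?m" "0 < ?m'"
    using boundary_dist_pos[OF G] boundary_dist_pos[OF open_image[OF G(1)] image_neq_UNIV[OF G(2)]] xy by auto
  have "boundary_dist (f ` G) (f z) \<le> L * boundary_dist G z" for z
    using G xy by (intro boundary_dist_image) auto
  from this[of x] this[of y] have "?m' \<le> L * ?m" by (auto simp: min_def)
  then have "dist x y * ?m' \<le> (L * dist (f x) (f y)) * (L * ?m)"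
    using lower[of x y] pos by (intro mult_mono) (auto intro: order_trans[OF zero_le_dist])
  then show ?thesis using pos by (simp add: divide_simps power2_eq_square mult_ac)
qed

lemma phi_uniform_image:
  assumes "phi_uniform \<phi> G"
  shows "phi_uniform (\<lambda>t. L\<^sup>2 * \<phi> (L\<^sup>2 * t)) (f ` G)"
proof -
  obtain \<psi> where \<psi>: "homeomorphism {0..} {0..} \<phi> \<psi>" and G: "open G" "connected G" "G \<noteq> {}" "G \<noteq> UNIV"
    and k: "\<And>x y. \<lbrakk>x \<in> G; y \<in> G\<rbrakk> \<Longrightarrow> quasihyperbolic_dist G x y
        \<le> \<phi> (norm (x - y) / min (boundary_dist G x) (boundary_dist G y))"
    using assms unfolding phi_uniform_def euclidean_domain_def by blast
  have k': "quasihyperbolic_dist (f ` G) (f x) (f y)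
      \<le> L\<^sup>2 * \<phi> (L\<^sup>2 * (norm (f x - f y) / min (boundary_dist (f ` G) (f x)) (boundary_dist (f ` G) (f y))))"
    if xy: "x \<in> G" "y \<in> G" for x y
  proof -
    let ?r = "dist x y / min (boundary_dist G x) (boundary_dist G y)"
    let ?r' = "dist (f x) (f y) / min (boundary_dist (f ` G) (f x)) (boundary_dist (f ` G) (f y))"
    \<comment> \<open>Nonnegativity is required because \<open>\<phi>\<close> is known to be
      increasing only on \<open>{0..}\<close>.\<close>
    have "0 \<le> ?r" by (simp add: boundary_dist_def infdist_nonneg)
    moreover have le: "?r \<le> L\<^sup>2 * ?r'" using G(1,4) xy by (rule relative_dist_image_ge)
    ultimately have "\<phi> ?r \<le> \<phi> (L\<^sup>2 * ?r')"
      using strict_mono_on_leD[OF strict_mono_on_homeomorphism_nonneg[OF \<psi>], of ?r "L\<^sup>2 * ?r'"]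
      by (simp only: atLeast_iff order_trans[OF _ le])
    then have "quasihyperbolic_dist G x y \<le> \<phi> (L\<^sup>2 * ?r')" using k[OF xy] by (simp add: dist_norm)
    then have "L\<^sup>2 * quasihyperbolic_dist G x y \<le> L\<^sup>2 * \<phi> (L\<^sup>2 * ?r')" by (rule mult_left_mono) simp
    then show ?thesis
      using quasihyperbolic_dist_image_le[OF G(1,2,4) xy] by (simp add: dist_norm)
  qed
  have "\<exists>\<psi>. homeomorphism {0..} {0..} (\<lambda>t. L\<^sup>2 * \<phi> (L\<^sup>2 * t)) \<psi>"
    using homeomorphism_nonneg_rescale[OF \<psi>, of "L\<^sup>2"] L_pos by auto
  moreover have "euclidean_domain (f ` G)" "f ` G \<noteq> UNIV"
    using G open_image image_neq_UNIV connected_continuous_image[OF continuous_on]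
    by (auto simp: euclidean_domain_def)
  ultimately show ?thesis
    unfolding phi_uniform_def ball_simps using k' by (intro conjI ballI)
qed

end

theorem proposition3p10:
  fixes f :: "real ^ 'n \<Rightarrow> real ^ 'n"
    and G :: "(real ^ 'n) set"
    and \<phi> :: "real \<Rightarrow> real"
    and L :: real
  assumes "CARD('n) \<ge> 2"
    and "L > 0"
    and "\<forall>x y. norm (x - y) / L \<le> norm (f x - f y) \<and> norm (f x - f y) \<le> L * norm (x - y)"
    and "phi_uniform \<phi> G"
  shows "phi_uniform (\<lambda>t. L\<^sup>2 * \<phi> (L\<^sup>2 * t)) (f ` G)"
proof -
  interpret bilipschitz_map f L
    using assms(2,3) by unfold_locales (auto simp: dist_norm field_simps)
  show ?thesis using assms(4) by (rule phi_uniform_image)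
qed

end
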